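(* Let $(a,x_1,x_2,x_3)\in\mathbb C^4$. Then the following are equivalent: (1) $(a,x_1,x_2,x_3)\in\mathbb H_\mu$; (2) $(x_1,x_2,x_3)\in\mathbb E$ and $|a|K_*(x_1,x_2,x_3)<1$; in addition, $x_1x_2=x_3$ if $a=0$; (3) $(x_1,x_2,x_3)\in\mathbb E$ and $\sup_{z_1,z_2\in\mathbb D}|\psi_{z_1,z_2}(a,x_1,x_2,x_3)|<1$; in addition, $x_1x_2=x_3$ if $a=0$. Therefore, $\mathbb H_\mu\cap(\{0\}\times\mathbb E)=\{(0,x_1,x_2,x_3)\in\mathbb H_\mu : x_1x_2=x_3\}$.
   Context: $\mathbb D$ is the open unit disc in $\mathbb C$, $\overline{\mathbb D}$ its closure; $\|\cdot\|$ is the operator norm on $M_2(\mathbb C)$ induced by the Euclidean norm on $\mathbb C^2$. Let $E\subset M_2(\mathbb C)$ be the linear space of all upper triangular matrices. For $A\in M_2(\mathbb C)$, $$\mu_{\mathrm{hexa}}(A)=\frac{1}{\inf\{\|X\| : X\in E,\ \det(I-AX)=0\}},$$ with $\mu_{\mathrm{hexa}}(A)=0$ if $\det(I-AX)\ne0$ for all $X\in E$. $\pi:M_2(\mathbb C)\to\mathbb C^4$ is $\pi((a_{ij}))=(a_{21},a_{11},a_{22},\det(A))$, and the $\mu$-hexablock is $\mathbb H_\mu=\{\pi(A): A\in M_2(\mathbb C),\ \mu_{\mathrm{hexa}}(A)<1\}$. The tetrablock is $\mathbb E=\{(x_1,x_2,x_3)\in\mathbb C^3: 1-x_1z_1-x_2z_2+x_3z_1z_2\ne0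 \text{ for all } z_1,z_2\in\overline{\mathbb D}\}$. For $(a,x_1,x_2,x_3)\in\mathbb C\times\mathbb E$ and $z_1,z_2\in\overline{\mathbb D}$, $\psi_{z_1,z_2}(a,x_1,x_2,x_3)=\dfrac{a\sqrt{(1-|z_1|^2)(1-|z_2|^2)}}{1-x_1z_1-x_2z_2+x_3z_1z_2}$. For $(x_1,x_2,x_3)\in\mathbb E$, $K_*(x_1,x_2,x_3)=\max_{z_1,z_2\in\overline{\mathbb D}}\left|\dfrac{\sqrt{(1-|z_1|^2)(1-|z_2|^2)}}{1-x_1z_1-x_2z_2+x_3z_1z_2}\right|$. *)

theory Defs
  imports "HOL-Analysis.Analysis"
begin

definition upper_triangular2 :: "(complex^2^2) set" where
  "upper_triangular2 = {X. X $ 2 $ 1 = 0}"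

text \<open>The instance norm of \<open>complex^2\<close> is Euclidean, while that of \<open>complex^2^2\<close> is the
  Frobenius norm; the operator norm has to be taken explicitly with \<^const>\<open>onorm\<close>.\<close>

definition mu_hexa :: "complex^2^2 \<Rightarrow> real" where
  "mu_hexa A =
    (if \<forall>X\<in>upper_triangular2. det (mat 1 - A ** X) \<noteq> 0 then 0
     else 1 / Inf {onorm ((*v) X) | X. X \<in> upper_triangular2 \<and> det (mat 1 - A ** X) = 0})"

definition hexa_pi :: "complex^2^2 \<Rightarrow> complex \<times> complex \<times> complex \<times> complex" where
  "hexa_pi A = (A $ 2 $ 1, A $ 1 $ 1, A $ 2 $ 2, det A)"

definition mu_hexablock :: "(complex \<times> complex \<times> complex \<times> complex) set" where
  "mu_hexablock = {hexa_pi A | A. mu_hexa A < 1}"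

definition tetrablock :: "(complex \<times> complex \<times> complex) set" where
  "tetrablock = {(x1, x2, x3).
     \<forall>z1\<in>cball 0 1. \<forall>z2\<in>cball 0 1. 1 - x1 * z1 - x2 * z2 + x3 * z1 * z2 \<noteq> 0}"

text \<open>The next two functions are meaningful only for \<open>(x1, x2, x3)\<close> in the tetrablock, where
  the denominator has no zero on the closed bidisc; elsewhere their values are arbitrary.\<close>

definition hexa_psi ::
  "complex \<Rightarrow> complex \<Rightarrow> complex \<times> complex \<times> complex \<times> complex \<Rightarrow> complex" where
  "hexa_psi z1 z2 = (\<lambda>(a, x1, x2, x3).
     a * of_real (sqrt ((1 - (norm z1)\<^sup>2) * (1 - (norm z2)\<^sup>2)))
       / (1 - x1 * z1 - x2 * z2 + x3 * z1 * z2))"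

text \<open>\<open>GREATEST\<close> renders the maximum (an attained value, not only a supremum).\<close>

definition K_star :: "complex \<times> complex \<times> complex \<Rightarrow> real" where
  "K_star = (\<lambda>(x1, x2, x3). GREATEST k. \<exists>z1\<in>cball 0 1. \<exists>z2\<in>cball 0 1.
     k = norm (of_real (sqrt ((1 - (norm z1)\<^sup>2) * (1 - (norm z2)\<^sup>2)))
               / (1 - x1 * z1 - x2 * z2 + x3 * z1 * z2)))"

end

theory Submission
  imports Defs
begin

text \<open>For an upper triangular \<open>X\<close> with diagonal \<open>z1, z2\<close> and corner \<open>w\<close>, the determinant
  \<open>det (1 - A X)\<close> equals \<open>1 - x1 z1 - x2 z2 + x3 z1 z2 - a w\<close>, where
  \<open>(a, x1, x2, x3) = \<pi> A\<close>. On the other hand, \<open>X\<close> is a contraction exactly when \<open>z1, z2\<close> lie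
  in the closed disc and \<open>|w|\<^sup>2 \<le> (1 - |z1|\<^sup>2) (1 - |z2|\<^sup>2)\<close>
  (\<open>upper_triangular_onorm_le_1_iff\<close>). The infimum in the definition of \<open>\<mu>\<close> is attained, so
  \<open>\<mu> A < 1\<close> says that \<open>det (1 - A X)\<close> does not vanish for any upper triangular contraction
  \<open>X\<close>. As \<open>w\<close> runs through a disc with centre \<open>0\<close> for fixed \<open>z1, z2\<close>, this means that
  \<open>|a| \<surd>((1 - |z1|\<^sup>2) (1 - |z2|\<^sup>2)) < |1 - x1 z1 - x2 z2 + x3 z1 z2|\<close> on the closed bidisc
  (\<open>mu_hexa_less_1_iff_coordinates\<close>).

  The left side is nonnegative, so this inequality contains membership in the tetrablock, and
  dividing by the right side turns it into \<open>|a| K\<^sub>* < 1\<close>. The function under the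
  maximum in \<open>K\<^sub>*\<close> vanishes when \<open>z1\<close> or \<open>z2\<close> is unimodular, and therefore the
  supremum over the open bidisc serves as well. The condition for \<open>a = 0\<close> describes the range of
  \<open>\<pi>\<close>: the determinant of a triangular matrix is \<open>x1 x2\<close>, while for \<open>a \<noteq> 0\<close> the upper
  right entry can be chosen to give \<open>A\<close> any determinant.\<close>

section \<open>Upper triangular contractions\<close>

lemma norm_vec2_power2: "(norm (x :: 'a::real_normed_vector^2))\<^sup>2 = (norm (x$1))\<^sup>2 + (norm (x$2))\<^sup>2"
  by (simp add: norm_vec_def L2_set_def sum_2)

lemma onorm_le_iff:
  fixes X :: "complex^'n^'m"
  assumes "0 \<le> r"
  shows "onorm ((*v) X) \<le> r \<longleftrightarrow> (\<forall>x. norm (X *v x) \<le> r * norm x)"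
proof
  assume le: "onorm ((*v) X) \<le> r"
  have "norm (X *v x) \<le> r * norm x" for x
    using onorm[OF matrix_vector_mul_bounded_linear, of X x] mult_right_mono[OF le norm_ge_zero[of x]]
    by linarith
  then show "\<forall>x. norm (X *v x) \<le> r * norm x" by blast
qed (use assms in \<open>auto intro: onorm_bound\<close>)

lemma upper_triangular_mult_vector:
  fixes X :: "complex^2^2"
  assumes "X $ 2 $ 1 = 0"
  shows "(X *v x) $ 1 = X $ 1 $ 1 * x $ 1 + X $ 1 $ 2 * x $ 2" "(X *v x) $ 2 = X $ 2 $ 2 * x $ 2"
  using assms by (simp_all add: matrix_vector_mult_def sum_2)

text \<open>Sufficiency of the condition on the right is the Cauchy-Schwarz inequality. For necessity,
  the standard basis vectors bound the diagonal, and the bound on the corner comes from the vectors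
  \<open>(t (cnj u) w, 1)\<close>, for which the two terms of the first coordinate \<open>u x + w y\<close> have the same
  argument; it remains to choose \<open>t\<close>.\<close>
lemma upper_triangular_onorm_le_1_iff:
  fixes X :: "complex^2^2"
  assumes X: "X $ 2 $ 1 = 0"
  defines "u \<equiv> X $ 1 $ 1" and "v \<equiv> X $ 2 $ 2" and "w \<equiv> X $ 1 $ 2"
  shows "onorm ((*v) X) \<le> 1 \<longleftrightarrow>
    norm u \<le> 1 \<and> norm v \<le> 1 \<and> (norm w)\<^sup>2 \<le> (1 - (norm u)\<^sup>2) * (1 - (norm v)\<^sup>2)"
proof -
  have sq: "(norm (X *v x))\<^sup>2 = (norm (u * x$1 + w * x$2))\<^sup>2 + (norm v * norm (x$2))\<^sup>2" for x
    unfolding norm_vec2_power2 upper_triangular_mult_vector[OF X] u_def v_def w_def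
    by (simp add: norm_mult)
  have "onorm ((*v) X) \<le> 1 \<longleftrightarrow> (\<forall>x. (norm (X *v x))\<^sup>2 \<le> (norm x)\<^sup>2)"
    by (simp add: onorm_le_iff)
  also have "\<dots> \<longleftrightarrow> (\<forall>x y. (norm (u * x + w * y))\<^sup>2 + (norm v * norm y)\<^sup>2 \<le> (norm x)\<^sup>2 + (norm y)\<^sup>2)"
    (is "_ \<longleftrightarrow> ?C")
    unfolding sq unfolding norm_vec2_power2
  proof (intro iffI allI)
    fix x y
    assume "\<forall>x :: complex^2. (norm (u * x$1 + w * x$2))\<^sup>2 + (norm v * norm (x$2))\<^sup>2
        \<le> (norm (x$1))\<^sup>2 + (norm (x$2))\<^sup>2"
    from this[rule_format, of "vector [x, y]"]
    show "(norm (u * x + w * y))\<^sup>2 + (norm v * norm y)\<^sup>2 \<le> (norm x)\<^sup>2 + (norm y)\<^sup>2" by simp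
  qed simp
  also have "\<dots> \<longleftrightarrow> norm u \<le> 1 \<and> norm v \<le> 1 \<and> (norm w)\<^sup>2 \<le> (1 - (norm u)\<^sup>2) * (1 - (norm v)\<^sup>2)"
  proof
    assume C: ?C
    have "(norm u)\<^sup>2 \<le> 1" using C[rule_format, of 1 0] by simp
    then have u: "norm u \<le> 1" using power2_le_imp_le[of "norm u" 1] by simp
    have vw: "(norm w)\<^sup>2 + (norm v)\<^sup>2 \<le> 1" using C[rule_format, of 0 1] by simp
    then have v: "norm v \<le> 1" using power2_le_imp_le[of "norm v" 1] zero_le_power2[of "norm w"]
      by simp
    let ?p = "(norm u)\<^sup>2" and ?s = "(norm w)\<^sup>2"
    have key: "?s * (t * ?p + 1)\<^sup>2 + (norm v)\<^sup>2 \<le> t\<^sup>2 * ?p * ?s + 1" for t :: real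
    proof -
      have "u * (of_real t * cnj u * w) + w * 1 = of_real (t * ?p + 1) * w"
        using complex_norm_square[of u] by (simp add: algebra_simps)
      then have "(norm (u * (of_real t * cnj u * w) + w * 1))\<^sup>2 = (t * ?p + 1)\<^sup>2 * ?s"
        by (simp only: norm_mult norm_of_real power_mult_distrib power2_abs)
      then show ?thesis using C[rule_format, of "of_real t * cnj u * w" 1]
        by (simp add: norm_mult power_mult_distrib algebra_simps)
    qed
    have "?s \<le> (1 - ?p) * (1 - (norm v)\<^sup>2)"
    proof (cases "?p = 1")
      \<comment> \<open>Here the inequality in \<open>key\<close> reads \<open>(2 t + 1) |w|\<^sup>2 + |v|\<^sup>2 \<le> 1\<close>, which
        fails for large \<open>t\<close> unless \<open>w = 0\<close>.\<close>
      case True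
      have "?s \<le> 0"
      proof (rule ccontr)
        assume "\<not> ?s \<le> 0"
        then have "?s > 0" by simp
        then have "w \<noteq> 0" by auto
        then have "?s * (1 / ?s + 1)\<^sup>2 = (1 / ?s)\<^sup>2 * ?s + 2 + ?s"
          by (simp add: power2_eq_square field_simps)
        with key[of "1 / ?s"] True \<open>?s > 0\<close> zero_le_power2[of "norm v"] show False by simp
      qed
      with True show ?thesis by simp
    next
      case False
      with u have d: "1 - ?p > 0" by (simp add: abs_square_less_1 power2_eq_1_iff abs_square_le_1 order_less_le)
      \<comment> \<open>This \<open>t\<close> makes the test vector proportional to \<open>((cnj u) w, 1 - |u|\<^sup>2)\<close>, which
        maximises \<open>|X x|\<^sup>2 - |x|\<^sup>2\<close> over the first coordinate.\<close>
      let ?t = "1 / (1 - ?p)"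
      have t: "?t * (1 - ?p) = 1" using d by simp
      have e: "?t * ?p + 1 = ?t" using d by (simp add: field_simps)
      have "?s * ?t\<^sup>2 * (1 - ?p) \<le> 1 - (norm v)\<^sup>2"
        using key[of ?t] unfolding e by (simp add: algebra_simps)
      also have "?s * ?t\<^sup>2 * (1 - ?p) = ?s * ?t"
        using t by (simp add: power2_eq_square)
      finally show ?thesis using d by (simp add: field_simps)
    qed
    with u v show "norm u \<le> 1 \<and> norm v \<le> 1 \<and> ?s \<le> (1 - ?p) * (1 - (norm v)\<^sup>2)" by blast
  next
    assume R: "norm u \<le> 1 \<and> norm v \<le> 1 \<and> (norm w)\<^sup>2 \<le> (1 - (norm u)\<^sup>2) * (1 - (norm v)\<^sup>2)"
    define s t where "s = sqrt (1 - (norm u)\<^sup>2)" and "t = sqrt (1 - (norm v)\<^sup>2)"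
    have s2: "s\<^sup>2 = 1 - (norm u)\<^sup>2" and t2: "t\<^sup>2 = 1 - (norm v)\<^sup>2" and st: "0 \<le> s" "0 \<le> t"
      using R by (simp_all add: s_def t_def abs_square_le_1)
    have w: "norm w \<le> s * t"
      by (rule power2_le_imp_le) (use R st in \<open>simp_all add: power_mult_distrib s2 t2\<close>)
    show ?C
    proof (intro allI)
      fix x y
      have "norm (u * x + w * y) \<le> norm u * norm x + s * (t * norm y)"
        using norm_triangle_ineq[of "u * x" "w * y"] mult_right_mono[OF w norm_ge_zero[of y]]
        by (simp add: norm_mult)
      then have "(norm (u * x + w * y))\<^sup>2 \<le> (norm u * norm x + s * (t * norm y))\<^sup>2"
        by (intro power_mono) auto
      also have "\<dots> \<le> ((norm u)\<^sup>2 + s\<^sup>2) * ((norm x)\<^sup>2 + (t * norm y)\<^sup>2)"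
        using zero_le_power2[of "norm u * (t * norm y) - s * norm x"]
        by (simp add: power2_eq_square algebra_simps)
      also have "\<dots> = (norm x)\<^sup>2 + (norm y)\<^sup>2 - (norm v * norm y)\<^sup>2"
        by (simp add: s2 t2 power_mult_distrib algebra_simps)
      finally show "(norm (u * x + w * y))\<^sup>2 + (norm v * norm y)\<^sup>2 \<le> (norm x)\<^sup>2 + (norm y)\<^sup>2"
        by simp
    qed
  qed
  finally show ?thesis .
qed

lemma det_one_minus_mult_upper_triangular:
  fixes A X :: "complex^2^2"
  assumes "X $ 2 $ 1 = 0"
  shows "det (mat 1 - A ** X)
    = 1 - A$1$1 * X$1$1 - A$2$2 * X$2$2 + det A * X$1$1 * X$2$2 - A$2$1 * X$1$2"
  using assms by (simp add: det_2 matrix_matrix_mult_def sum_2 mat_def algebra_simps)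

section \<open>The structured singular value\<close>

text \<open>The operator norm is a supremum of continuous functions of the matrix, so its sublevel sets
  are closed, and they are bounded because the operator norm dominates every entry. Hence the
  sublevel sets for levels decreasing to the infimum form a nest of nonempty compact sets.\<close>
lemma onorm_attains_Inf:
  fixes S :: "(complex^'n^'m) set"
  assumes "closed S" "S \<noteq> {}"
  obtains X where "X \<in> S" "onorm ((*v) X) = Inf {onorm ((*v) X) | X. X \<in> S}"
proof -
  let ?N = "\<lambda>X::complex^'n^'m. onorm ((*v) X)"
  define m where "m = Inf {?N X | X. X \<in> S}"
  have N0: "0 \<le> ?N X" for X by (rule onorm_pos_le[OF matrix_vector_mul_bounded_linear])
  have bdd: "bdd_below {?N X | X. X \<in> S}" by (rule bdd_belowI[of _ 0]) (auto simp: N0)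
  have ne: "{?N X | X. X \<in> S} \<noteq> {}" using assms by blast
  have m0: "0 \<le> m" unfolding m_def by (rule cInf_greatest[OF ne]) (auto simp: N0)
  have m_le: "m \<le> ?N X" if "X \<in> S" for X
    unfolding m_def using that by (intro cInf_lower bdd) blast
  define F where "F n = S \<inter> {X. ?N X \<le> m + 1 / Suc n}" for n :: nat
  have compact: "compact (F n)" for n
  proof -
    let ?r = "m + 1 / Suc n"
    have r: "0 \<le> ?r" using m0 by simp
    have "closed {X. ?N X \<le> ?r}"
    proof -
      have "{X. ?N X \<le> ?r} = (\<Inter>x. {X. norm (X *v x) \<le> ?r * norm x})"
        unfolding onorm_le_iff[OF r] by blast
      moreover have "closed {X :: complex^'n^'m. norm (X *v x) \<le> ?r * norm x}" for x
        unfolding matrix_vector_mult_def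
        by (intro closed_Collect_le continuous_intros continuous_on_vec_lambda)
      ultimately show ?thesis by auto
    qed
    moreover have "bounded {X. ?N X \<le> ?r}"
    proof (rule boundedI)
      fix X :: "complex^'n^'m" assume "X \<in> {X. ?N X \<le> ?r}"
      then have b: "norm (X *v x) \<le> ?r * norm x" for x using onorm_le_iff[OF r] by blast
      have col: "norm (X $ i $ j) \<le> ?r" for i j
      proof -
        have "X $ i $ j = (X *v axis j 1) $ i"
          by (simp add: matrix_vector_mult_def axis_def if_distrib[of "(*) _"] cong: if_cong)
        then show ?thesis
          using b[of "axis j 1"] Finite_Cartesian_Product.norm_nth_le[of "X *v axis j 1" i] by simp
      qed
      have "norm X \<le> (\<Sum>i\<in>UNIV. norm (X $ i))" unfolding norm_vec_def by (intro L2_set_le_sum) simp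
      also have "\<dots> \<le> (\<Sum>i\<in>UNIV. \<Sum>j\<in>UNIV. norm (X $ i $ j))"
        unfolding norm_vec_def by (intro sum_mono L2_set_le_sum) simp
      also have "\<dots> \<le> (\<Sum>i\<in>(UNIV::'m set). \<Sum>j\<in>(UNIV::'n set). ?r)"
        by (intro sum_mono col)
      finally show "norm X \<le> (\<Sum>i\<in>(UNIV::'m set). \<Sum>j\<in>(UNIV::'n set). ?r)" .
    qed
    ultimately show ?thesis unfolding F_def compact_eq_bounded_closed
      using assms(1) by (auto intro: bounded_subset closed_Int)
  qed
  have "\<Inter> (range F) \<noteq> {}"
  proof (rule compact_nest[OF compact])
    fix n
    have "Inf {?N X | X. X \<in> S} < m + 1 / Suc n" by (simp add: m_def)
    from cInf_lessD[OF ne this] show "F n \<noteq> {}" unfolding F_def by force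
  next
    fix k n :: nat assume "k \<le> n"
    then have "1 / real (Suc n) \<le> 1 / real (Suc k)" by (simp add: field_simps)
    then show "F n \<subseteq> F k" unfolding F_def by force
  qed
  then obtain X where X: "\<And>n. X \<in> F n" by blast
  have "?N X \<le> m"
  proof (rule field_le_epsilon)
    fix e :: real assume "0 < e"
    then obtain n where "inverse (Suc n) < e" using reals_Archimedean by blast
    then show "?N X \<le> m + e" using X[of n] by (simp add: F_def inverse_eq_divide)
  qed
  with X[of 0] m_le[of X] show ?thesis by (intro that[of X]) (auto simp: F_def m_def)
qed

text \<open>Attainment of the infimum is used twice: it makes the infimum positive, since \<open>X = 0\<close> has
  \<open>det (1 - A X) = 1\<close> (so the reciprocal is never \<open>1 / 0 = 0\<close>), and it excludes that
  the infimum is \<open>1\<close> without a contraction attaining it.\<close>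
lemma mu_hexa_less_1_iff:
  "mu_hexa A < 1 \<longleftrightarrow>
    (\<forall>X\<in>upper_triangular2. onorm ((*v) X) \<le> 1 \<longrightarrow> det (mat 1 - A ** X) \<noteq> 0)"
proof -
  define S where "S = {X \<in> upper_triangular2. det (mat 1 - A ** X) = 0}"
  show ?thesis
  proof (cases "S = {}")
    case True
    then show ?thesis by (auto simp: S_def mu_hexa_def)
  next
    case False
    have "S = {X. X$2$1 = 0} \<inter>
        {X. 1 - A$1$1 * X$1$1 - A$2$2 * X$2$2 + det A * X$1$1 * X$2$2 - A$2$1 * X$1$2 = 0}"
      unfolding S_def upper_triangular2_def using det_one_minus_mult_upper_triangular by auto
    then have "closed S" by (auto intro!: closed_Int closed_Collect_eq continuous_intros)
    then obtain Y where Y: "Y \<in> S" "onorm ((*v) Y) = Inf {onorm ((*v) X) | X. X \<in> S}"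
      using onorm_attains_Inf False by blast
    have mu: "mu_hexa A = 1 / onorm ((*v) Y)"
      using False unfolding Y(2) mu_hexa_def S_def by auto
    have min: "onorm ((*v) Y) \<le> onorm ((*v) X)" if "X \<in> S" for X
      unfolding Y(2) using that
      by (intro cInf_lower bdd_belowI[of _ 0]) (auto intro: onorm_pos_le matrix_vector_mul_bounded_linear)
    have "onorm ((*v) Y) \<noteq> 0"
    proof
      assume "onorm ((*v) Y) = 0"
      then have "Y *v x = 0" for x using onorm_eq_0[OF matrix_vector_mul_bounded_linear] by blast
      then have "Y = 0" by (simp add: matrix_eq)
      with Y(1) show False by (simp add: S_def)
    qed
    then have pos: "0 < onorm ((*v) Y)"
      using onorm_pos_le[OF matrix_vector_mul_bounded_linear, of Y] by simp
    then have "mu_hexa A < 1 \<longleftrightarrow> 1 < onorm ((*v) Y)" by (simp add: mu)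
    also have "\<dots> \<longleftrightarrow> (\<forall>X\<in>S. \<not> onorm ((*v) X) \<le> 1)"
      using Y(1) min by force
    finally show ?thesis by (auto simp: S_def)
  qed
qed

text \<open>A corner \<open>w\<close> of a contraction with diagonal \<open>z1, z2\<close> that makes \<open>det (1 - A X)\<close> vanish
  solves \<open>a w = 1 - x1 z1 - x2 z2 + x3 z1 z2\<close>; a solution in the admissible disc exists if and
  only if the modulus of the right side is at most \<open>|a|\<close> times the radius.\<close>
lemma mu_hexa_less_1_iff_coordinates:
  "mu_hexa A < 1 \<longleftrightarrow>
    (\<forall>z1\<in>cball 0 1. \<forall>z2\<in>cball 0 1.
      norm (A$2$1) * sqrt ((1 - (norm z1)\<^sup>2) * (1 - (norm z2)\<^sup>2))
        < norm (1 - A$1$1 * z1 - A$2$2 * z2 + det A * z1 * z2))"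
  (is "_ \<longleftrightarrow> (\<forall>z1\<in>_. \<forall>z2\<in>_. ?a * ?R z1 z2 < norm (?d z1 z2))")
proof
  assume mu: "mu_hexa A < 1"
  show "\<forall>z1\<in>cball 0 1. \<forall>z2\<in>cball 0 1. ?a * ?R z1 z2 < norm (?d z1 z2)"
  proof (intro ballI, rule ccontr)
    fix z1 z2 :: complex assume z: "z1 \<in> cball 0 1" "z2 \<in> cball 0 1"
    assume "\<not> ?a * ?R z1 z2 < norm (?d z1 z2)"
    then have le: "norm (?d z1 z2) \<le> ?a * ?R z1 z2" by simp
    have R: "0 \<le> (1 - (norm z1)\<^sup>2) * (1 - (norm z2)\<^sup>2)"
      using z by (simp add: abs_square_le_1)
    \<comment> \<open>For \<open>a = 0\<close> the reversed inequality forces the right side to vanish,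
      so \<open>w = 0\<close> will do.\<close>
    obtain w where w: "A$2$1 * w = ?d z1 z2" "norm w \<le> ?R z1 z2"
    proof (cases "A$2$1 = 0")
      case True
      with le R that[of 0] show ?thesis by simp
    next
      case False
      with le that[of "?d z1 z2 / A$2$1"] show ?thesis
        by (simp add: norm_divide field_simps)
    qed
    have "(norm w)\<^sup>2 \<le> (1 - (norm z1)\<^sup>2) * (1 - (norm z2)\<^sup>2)"
      using power_mono[OF w(2) norm_ge_zero, of 2] R by simp
    moreover define X :: "complex^2^2" where "X = vector [vector [z1, w], vector [0, z2]]"
    ultimately have "onorm ((*v) X) \<le> 1"
      using z by (simp add: upper_triangular_onorm_le_1_iff)
    moreover have "det (mat 1 - A ** X) = 0"
      using w(1) by (simp add: det_one_minus_mult_upper_triangular X_def)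
    ultimately show False
      using mu by (simp add: mu_hexa_less_1_iff upper_triangular2_def X_def)
  qed
next
  assume H: "\<forall>z1\<in>cball 0 1. \<forall>z2\<in>cball 0 1. ?a * ?R z1 z2 < norm (?d z1 z2)"
  show "mu_hexa A < 1"
    unfolding mu_hexa_less_1_iff
  proof (intro ballI impI notI)
    fix X assume X: "X \<in> upper_triangular2" and le: "onorm ((*v) X) \<le> 1"
      and det: "det (mat 1 - A ** X) = 0"
    from X have X0: "X$2$1 = 0" by (simp add: upper_triangular2_def)
    note b = le[unfolded upper_triangular_onorm_le_1_iff[OF X0]]
    have "norm (X$1$2) \<le> ?R (X$1$1) (X$2$2)" using b by (auto intro: real_le_rsqrt)
    then have "?a * norm (X$1$2) \<le> ?a * ?R (X$1$1) (X$2$2)" by (rule mult_left_mono) simp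
    also have "\<dots> < norm (?d (X$1$1) (X$2$2))" using H b by simp
    also have "?d (X$1$1) (X$2$2) = A$2$1 * X$1$2"
      using det det_one_minus_mult_upper_triangular[OF X0, of A] by simp
    finally show False by (simp add: norm_mult)
  qed
qed

lemma mem_mu_hexablock_iff:
  "(a, x1, x2, x3) \<in> mu_hexablock \<longleftrightarrow>
    (\<forall>z1\<in>cball 0 1. \<forall>z2\<in>cball 0 1.
      norm a * sqrt ((1 - (norm z1)\<^sup>2) * (1 - (norm z2)\<^sup>2))
        < norm (1 - x1 * z1 - x2 * z2 + x3 * z1 * z2)) \<and>
    (a = 0 \<longrightarrow> x1 * x2 = x3)"
  (is "_ \<longleftrightarrow> ?ineq \<and> _")
proof
  assume "(a, x1, x2, x3) \<in> mu_hexablock"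
  then obtain A where "mu_hexa A < 1" "a = A$2$1" "x1 = A$1$1" "x2 = A$2$2" "x3 = det A"
    by (auto simp: mu_hexablock_def hexa_pi_def)
  then show "?ineq \<and> (a = 0 \<longrightarrow> x1 * x2 = x3)"
    using mu_hexa_less_1_iff_coordinates[of A] by (simp add: det_2)
next
  assume R: "?ineq \<and> (a = 0 \<longrightarrow> x1 * x2 = x3)"
  \<comment> \<open>For \<open>a = 0\<close> the corner is \<open>0\<close> by the convention for division, and the determinant is
    \<open>x1 x2 = x3\<close>.\<close>
  define A :: "complex^2^2" where "A = vector [vector [x1, (x1 * x2 - x3) / a], vector [a, x2]]"
  have pi: "hexa_pi A = (a, x1, x2, x3)"
    using R by (auto simp: hexa_pi_def A_def det_2)
  then have "mu_hexa A < 1"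
    using R by (simp add: mu_hexa_less_1_iff_coordinates hexa_pi_def)
  with pi show "(a, x1, x2, x3) \<in> mu_hexablock"
    unfolding mu_hexablock_def by (metis (mono_tags, lifting) mem_Collect_eq)
qed

section \<open>The functions \<open>\<psi>\<close> and \<open>K\<^sub>*\<close>\<close>

text \<open>The function maximised in \<open>K\<^sub>*\<close> is \<open>|\<psi>|\<close> at \<open>a = 1\<close>, which lets all estimates be
  stated in terms of \<open>\<psi>\<close>.\<close>
lemma norm_hexa_psi_eq:
  "norm (hexa_psi z1 z2 (a, x1, x2, x3)) = norm a * norm (hexa_psi z1 z2 (1, x1, x2, x3))"
  by (simp add: hexa_psi_def norm_mult norm_divide)

text \<open>Membership in the tetrablock makes the function continuous on the compact closed bidisc.
  The maximum therefore exists, as is required for \<open>GREATEST\<close> to have a meaningful value.\<close>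
lemma K_star_attained:
  assumes "(x1, x2, x3) \<in> tetrablock"
  obtains z1 z2 where "z1 \<in> cball 0 1" "z2 \<in> cball 0 1"
    "K_star (x1, x2, x3) = norm (hexa_psi z1 z2 (1, x1, x2, x3))"
    "\<And>y1 y2. y1 \<in> cball 0 1 \<Longrightarrow> y2 \<in> cball 0 1 \<Longrightarrow>
      norm (hexa_psi y1 y2 (1, x1, x2, x3)) \<le> K_star (x1, x2, x3)"
proof -
  let ?f = "\<lambda>p. norm (hexa_psi (fst p) (snd p) (1, x1, x2, x3))"
  have "continuous_on (cball 0 1 \<times> cball 0 1) ?f"
    using assms unfolding hexa_psi_def tetrablock_def
    by (auto intro!: continuous_intros)
  then obtain p where p: "p \<in> cball 0 1 \<times> cball 0 1"
    and max: "\<And>q. q \<in> cball 0 1 \<times> cball 0 1 \<Longrightarrow> ?f q \<le> ?f p"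
    using continuous_attains_sup[of "cball 0 1 \<times> cball 0 1 :: (complex \<times> complex) set" ?f]
    by (auto simp: compact_Times)
  have "K_star (x1, x2, x3) = ?f p"
    unfolding K_star_def prod.case using p max
    by (intro Greatest_equality) (fastforce simp: hexa_psi_def)+
  with p max show ?thesis by (intro that[of "fst p" "snd p"]) force+
qed

lemma tetrablock_iff_pos:
  "(x1, x2, x3) \<in> tetrablock \<longleftrightarrow> (\<forall>z1\<in>cball 0 1. \<forall>z2\<in>cball 0 1.
     0 < norm (1 - x1 * z1 - x2 * z2 + x3 * z1 * z2))"
  by (simp add: tetrablock_def)

lemma norm_mult_K_star_less_1_iff:
  "(x1, x2, x3) \<in> tetrablock \<and> norm a * K_star (x1, x2, x3) < 1 \<longleftrightarrow>
    (\<forall>z1\<in>cball 0 1. \<forall>z2\<in>cball 0 1.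
      norm a * sqrt ((1 - (norm z1)\<^sup>2) * (1 - (norm z2)\<^sup>2))
        < norm (1 - x1 * z1 - x2 * z2 + x3 * z1 * z2))"
  (is "_ \<longleftrightarrow> (\<forall>z1\<in>_. \<forall>z2\<in>_. ?l z1 z2 < ?d z1 z2)")
proof -
  have R: "0 \<le> (1 - (norm z1)\<^sup>2) * (1 - (norm z2)\<^sup>2)"
    if "z1 \<in> cball 0 1" "z2 \<in> cball 0 1" for z1 z2 :: complex
    using that by (simp add: abs_square_le_1)
  have T: "(x1, x2, x3) \<in> tetrablock" if "\<forall>z1\<in>cball 0 1. \<forall>z2\<in>cball 0 1. ?l z1 z2 < ?d z1 z2"
    unfolding tetrablock_iff_pos
  proof (intro ballI)
    fix z1 z2 :: complex assume z: "z1 \<in> cball 0 1" "z2 \<in> cball 0 1"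
    then have "0 \<le> ?l z1 z2" using R by simp
    also have "\<dots> < ?d z1 z2" using that z by blast
    finally show "0 < ?d z1 z2" .
  qed
  have "norm a * K_star (x1, x2, x3) < 1 \<longleftrightarrow> (\<forall>z1\<in>cball 0 1. \<forall>z2\<in>cball 0 1. ?l z1 z2 < ?d z1 z2)"
    if t: "(x1, x2, x3) \<in> tetrablock"
  proof -
    obtain m1 m2 where m: "m1 \<in> cball 0 1" "m2 \<in> cball 0 1"
      "K_star (x1, x2, x3) = norm (hexa_psi m1 m2 (1, x1, x2, x3))"
      "\<And>y1 y2. y1 \<in> cball 0 1 \<Longrightarrow> y2 \<in> cball 0 1 \<Longrightarrow>
        norm (hexa_psi y1 y2 (1, x1, x2, x3)) \<le> K_star (x1, x2, x3)"
      using K_star_attained[OF t] by blast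
    have "norm a * K_star (x1, x2, x3) < 1 \<longleftrightarrow>
      (\<forall>z1\<in>cball 0 1. \<forall>z2\<in>cball 0 1. norm a * norm (hexa_psi z1 z2 (1, x1, x2, x3)) < 1)"
    proof (intro iffI ballI)
      fix z1 z2 :: complex
      assume K: "norm a * K_star (x1, x2, x3) < 1" and z: "z1 \<in> cball 0 1" "z2 \<in> cball 0 1"
      show "norm a * norm (hexa_psi z1 z2 (1, x1, x2, x3)) < 1"
        using mult_left_mono[OF m(4)[OF z] norm_ge_zero[of a]] K by linarith
    next
      assume "\<forall>z1\<in>cball 0 1. \<forall>z2\<in>cball 0 1. norm a * norm (hexa_psi z1 z2 (1, x1, x2, x3)) < 1"
      then show "norm a * K_star (x1, x2, x3) < 1" unfolding m(3) using m(1,2) by blast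
    qed
    moreover have "norm a * norm (hexa_psi z1 z2 (1, x1, x2, x3)) < 1 \<longleftrightarrow> ?l z1 z2 < ?d z1 z2"
      if "z1 \<in> cball 0 1" "z2 \<in> cball 0 1" for z1 z2
    proof -
      have "0 < ?d z1 z2" using t that tetrablock_iff_pos by blast
      then show ?thesis using R[OF that] by (simp add: hexa_psi_def norm_divide divide_less_eq)
    qed
    ultimately show ?thesis by simp
  qed
  with T show ?thesis by blast
qed

text \<open>A maximum point of \<open>|\<psi>|\<close> in the open bidisc is seen by the supremum; if the maximum is
  attained on the boundary of the bidisc, then it is \<open>0\<close>.\<close>
lemma SUP_hexa_psi_less_1_iff:
  assumes t: "(x1, x2, x3) \<in> tetrablock"
  shows "(SUP (z1, z2) \<in> ball 0 1 \<times> ball 0 1. norm (hexa_psi z1 z2 (a, x1, x2, x3))) < 1 \<longleftrightarrow>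
    norm a * K_star (x1, x2, x3) < 1"
proof -
  let ?S = "SUP (z1, z2) \<in> ball 0 1 \<times> ball 0 1. norm (hexa_psi z1 z2 (a, x1, x2, x3))"
  obtain m1 m2 where m: "m1 \<in> cball 0 1" "m2 \<in> cball 0 1"
    "K_star (x1, x2, x3) = norm (hexa_psi m1 m2 (1, x1, x2, x3))"
    "\<And>y1 y2. y1 \<in> cball 0 1 \<Longrightarrow> y2 \<in> cball 0 1 \<Longrightarrow>
      norm (hexa_psi y1 y2 (1, x1, x2, x3)) \<le> K_star (x1, x2, x3)"
    using K_star_attained[OF t] by blast
  have ub: "norm (hexa_psi z1 z2 (a, x1, x2, x3)) \<le> norm a * K_star (x1, x2, x3)"
    if "z1 \<in> ball 0 1" "z2 \<in> ball 0 1" for z1 z2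
    unfolding norm_hexa_psi_eq[of _ _ a] using that by (intro mult_left_mono m(4)) auto
  have S_le: "?S \<le> norm a * K_star (x1, x2, x3)"
    by (rule cSUP_least) (auto intro: ub)
  have le_S: "norm (hexa_psi z1 z2 (a, x1, x2, x3)) \<le> ?S" if "z1 \<in> ball 0 1" "z2 \<in> ball 0 1" for z1 z2
    using that ub
    by (intro cSUP_upper2[where x = "(z1, z2)"] bdd_aboveI2[where M = "norm a * K_star (x1, x2, x3)"]) auto
  have "norm a * K_star (x1, x2, x3) < 1" if "?S < 1"
  proof (cases "m1 \<in> ball 0 1 \<and> m2 \<in> ball 0 1")
    case True
    then show ?thesis using le_S[of m1 m2] that unfolding m(3) norm_hexa_psi_eq[of _ _ a] by linarith
  next
    case False
    then have "norm m1 = 1 \<or> norm m2 = 1" using m(1,2) by auto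
    then show ?thesis unfolding m(3) by (auto simp: hexa_psi_def)
  qed
  with S_le show ?thesis by linarith
qed

theorem corollary3p8:
  shows "(\<forall>a x1 x2 x3 :: complex.
      ((a, x1, x2, x3) \<in> mu_hexablock \<longleftrightarrow>
         (x1, x2, x3) \<in> tetrablock \<and> norm a * K_star (x1, x2, x3) < 1 \<and>
         (a = 0 \<longrightarrow> x1 * x2 = x3)) \<and>
      ((a, x1, x2, x3) \<in> mu_hexablock \<longleftrightarrow>
         (x1, x2, x3) \<in> tetrablock \<and>
         (SUP (z1, z2) \<in> ball 0 1 \<times> ball 0 1. norm (hexa_psi z1 z2 (a, x1, x2, x3))) < 1 \<and>
         (a = 0 \<longrightarrow> x1 * x2 = x3)))
    \<and> mu_hexablock \<inter> ({0} \<times> tetrablock)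
        = {(0, x1, x2, x3) | x1 x2 x3. (0, x1, x2, x3) \<in> mu_hexablock \<and> x1 * x2 = x3}"
proof -
  have K: "(a, x1, x2, x3) \<in> mu_hexablock \<longleftrightarrow>
      (x1, x2, x3) \<in> tetrablock \<and> norm a * K_star (x1, x2, x3) < 1 \<and>
      (a = 0 \<longrightarrow> x1 * x2 = x3)" for a x1 x2 x3
    unfolding mem_mu_hexablock_iff norm_mult_K_star_less_1_iff[symmetric] by blast
  have "mu_hexablock \<inter> ({0} \<times> tetrablock)
      = {(0, x1, x2, x3) | x1 x2 x3. (0, x1, x2, x3) \<in> mu_hexablock \<and> x1 * x2 = x3}"
    using K[of 0] by auto
  moreover have "(a, x1, x2, x3) \<in> mu_hexablock \<longleftrightarrow>
      (x1, x2, x3) \<in> tetrablock \<and>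
      (SUP (z1, z2) \<in> ball 0 1 \<times> ball 0 1. norm (hexa_psi z1 z2 (a, x1, x2, x3))) < 1 \<and>
      (a = 0 \<longrightarrow> x1 * x2 = x3)" for a x1 x2 x3
    using K SUP_hexa_psi_less_1_iff by (metis (no_types, lifting))
  ultimately show ?thesis using K by (intro conjI allI)
qed

end
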